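(* Let $M$ be a manifold and $H$ a $3$-form on $M$. The $2$-form $\phi_2^H\in\Omega^2(\mathfrak{C}_2(M))$ is the simplicial coboundary of $\phi_1^H\in\Omega^2(\mathfrak{C}_1(M))$, i.e. $\phi_2^H=\delta\phi_1^H$.
   Context: Fix integers $p\ge q\ge 0$ with $p\ge1$. A map $\phi$ into a vector bundle $\pi:E\to M$ is $C^{p,q}$ if $\phi$ is $C^q$ and $\pi\circ\phi$ is $C^p$. $\Delta^n\subset\mathbb{R}^n$ is the standard $n$-simplex with vertices ordered $0,\dots,n$ ($\Delta^1=[0,1]$, and $\partial\Delta^2$ has the induced boundary orientation). $\mathfrak{C}_n(M)$ is the Banach manifold of $C^{p,q}$ bundle maps $T\Delta^n\to T^*M$; these form a simplicial manifold with faces $d_i$ obtained by precomposition with the tangent maps of the cofaces of $\Delta^\bullet$. A tangent vector at $\varphi\in\mathfrak{C}_n(M)$ with base map $f:\Delta^n\to M$ is a $C^{p,q}$ lift $X:T\Delta^n\to T(T^*M)$ of $\varphi$, linear over $TM$, with $C^p$ base map $X_0:\Delta^n\to TM$ covering $f$. For $X,Y\in T_\varphi\mathfrak{C}_n(M)$, $H^n_{X,Y}$ is the $1$-form on $\Delta^n$ given at $s\in\Delta^n$ by $v\mapsto H(X_0(s),Y_0(s),Tf(v))$. Define $\phi_1^H(X,Y)=\int_{\Delta^1}H^1_{X,Y}$ and $\phi_2^H(X,Y)=\int_{\Delta^2}dH^2_{X,Y}=\int_{\partial\Delta^2}H^2_{X,Y}$ (the boundary integral being the definition when differentiability is too low).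 The simplicial coboundary of a form $\alpha$ on $X_n$, for a simplicial manifold $X_\bullet$, is $\delta\alpha=\sum_{i=0}^{n+1}(-1)^id_i^*\alpha$. *)

theory Defs
  imports "HOL-Analysis.Analysis"
begin

section \<open>Differentiability classes\<close>

text \<open>
  Derivatives are taken within S, so the notion applies to open sets and to convex
  sets with nonempty interior (simplices, where it gives one-sided derivatives at the boundary).
  The derivatives of order at least 2 are described by the directional derivatives
  of the derivative; for finite-dimensional domains, the only ones used below, this is the usual
  notion of a map of class C^k.
\<close>

primrec Ck_on :: "nat \<Rightarrow> 'a::real_normed_vector set \<Rightarrow> ('a \<Rightarrow> 'b::real_normed_vector) \<Rightarrow> bool" where
  "Ck_on 0 S f \<longleftrightarrow> continuous_on S f"
| "Ck_on (Suc k) S f \<longleftrightarrow>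
     (\<exists>f' :: 'a \<Rightarrow> 'a \<Rightarrow>\<^sub>L 'b. continuous_on S f' \<and>
        (\<forall>x\<in>S. (f has_derivative blinfun_apply (f' x)) (at x within S)) \<and>
        (\<forall>v. Ck_on k S (\<lambda>x. blinfun_apply (f' x) v)))"

definition smooth_on :: "'a::real_normed_vector set \<Rightarrow> ('a \<Rightarrow> 'b::real_normed_vector) \<Rightarrow> bool" where
  "smooth_on S f \<longleftrightarrow> (\<forall>k. Ck_on k S f)"


section \<open>Smooth manifolds\<close>

text \<open>
  A manifold is given by a smooth atlas of charts \<open>(U, \<psi>)\<close>; its underlying set is the union of
  the chart domains and its topology is the one generated by the charts.  The model space is any
  normed space of finite dimension (dimension 0 included).
\<close>

type_synonym ('m, 'e) chart = "'m set \<times> ('m \<Rightarrow> 'e)"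

abbreviation chart_dom :: "('m, 'e) chart \<Rightarrow> 'm set" where "chart_dom \<equiv> fst"
abbreviation chart_map :: "('m, 'e) chart \<Rightarrow> 'm \<Rightarrow> 'e" where "chart_map \<equiv> snd"

definition chart_inv :: "('m, 'e) chart \<Rightarrow> 'e \<Rightarrow> 'm" where
  "chart_inv c = inv_into (chart_dom c) (chart_map c)"

definition points :: "('m, 'e) chart set \<Rightarrow> 'm set" where
  "points A = (\<Union>c\<in>A. chart_dom c)"

definition charts_at :: "('m, 'e) chart set \<Rightarrow> 'm \<Rightarrow> ('m, 'e) chart set" where
  "charts_at A x = {c \<in> A. x \<in> chart_dom c}"

definition transition :: "('m, 'e) chart \<Rightarrow> ('m, 'e) chart \<Rightarrow> 'e \<Rightarrow> 'e" where
  "transition c d = chart_map d \<circ> chart_inv c"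

definition atlas_topology :: "('m, 'e::real_normed_vector) chart set \<Rightarrow> 'm topology" where
  "atlas_topology A =
     topology_generated_by {W. \<exists>c\<in>A. W \<subseteq> chart_dom c \<and> open (chart_map c ` W)}"

definition smooth_atlas :: "('m, 'e::real_normed_vector) chart set \<Rightarrow> bool" where
  "smooth_atlas A \<longleftrightarrow>
     (\<forall>c\<in>A. inj_on (chart_map c) (chart_dom c) \<and> open (chart_map c ` chart_dom c)) \<and>
     (\<forall>c\<in>A. \<forall>d\<in>A. open (chart_map c ` (chart_dom c \<inter> chart_dom d)) \<and>
        smooth_on (chart_map c ` (chart_dom c \<inter> chart_dom d)) (transition c d))"

definition smooth_manifold :: "('m, 'e::real_normed_vector) chart set \<Rightarrow> bool" where
  "smooth_manifold A \<longleftrightarrow>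
     (\<exists>B :: 'e set. finite B \<and> span B = UNIV) \<and>
     smooth_atlas A \<and>
     Hausdorff_space (atlas_topology A) \<and> second_countable (atlas_topology A)"

definition Ck_map :: "nat \<Rightarrow> 'a::real_normed_vector set \<Rightarrow> ('m, 'e::real_normed_vector) chart set \<Rightarrow>
    ('a \<Rightarrow> 'm) \<Rightarrow> bool" where
  "Ck_map k S A g \<longleftrightarrow> g ` S \<subseteq> points A \<and>
     (\<forall>c\<in>A. openin (top_of_set S) (S \<inter> g -` chart_dom c) \<and>
        Ck_on k (S \<inter> g -` chart_dom c) (chart_map c \<circ> g))"


section \<open>Tangent and cotangent bundles\<close>

text \<open>
  A tangent vector at x is the family of its components in all charts around x,
  related by the derivatives of the transition maps (and 0 at every other index).
  Vector space operations are pointwise.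
\<close>

type_synonym ('m, 'e) tvec = "('m, 'e) chart \<Rightarrow> 'e"

definition tangent_space :: "('m, 'e::real_normed_vector) chart set \<Rightarrow> 'm \<Rightarrow> ('m, 'e) tvec set" where
  "tangent_space A x =
     {\<xi>. (\<forall>c\<in>charts_at A x. \<forall>d\<in>charts_at A x.
             \<xi> d = frechet_derivative (transition c d) (at (chart_map c x)) (\<xi> c)) \<and>
          (\<forall>c. c \<notin> charts_at A x \<longrightarrow> \<xi> c = 0)}"

definition tangent_chart :: "('m, 'e::real_normed_vector) chart set \<Rightarrow> ('m, 'e) chart \<Rightarrow>
    ('m \<times> ('m, 'e) tvec, 'e \<times> 'e) chart" where
  "tangent_chart A c =
     ({(x, \<xi>). x \<in> chart_dom c \<and> \<xi> \<in> tangent_space A x}, \<lambda>(x, \<xi>). (chart_map c x, \<xi> c))"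

definition tangent_bundle :: "('m, 'e::real_normed_vector) chart set \<Rightarrow>
    ('m \<times> ('m, 'e) tvec, 'e \<times> 'e) chart set" where
  "tangent_bundle A = tangent_chart A ` A"

definition coord_vector :: "('m, 'e::real_normed_vector) chart set \<Rightarrow> ('m, 'e) chart \<Rightarrow> 'm \<Rightarrow> 'e \<Rightarrow>
    ('m, 'e) tvec" where
  "coord_vector A c x u = (\<lambda>d. if d \<in> charts_at A x
     then frechet_derivative (transition c d) (at (chart_map c x)) u else 0)"

text \<open>Covectors are linear functionals on the tangent space, extended by 0 outside of it.\<close>

type_synonym ('m, 'e) covec = "('m, 'e) tvec \<Rightarrow> real"

definition cotangent_space :: "('m, 'e::real_normed_vector) chart set \<Rightarrow> 'm \<Rightarrow> ('m, 'e) covec set" where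
  "cotangent_space A x =
     {\<alpha>. (\<forall>\<xi>\<in>tangent_space A x. \<forall>\<eta>\<in>tangent_space A x. \<forall>a b.
             \<alpha> (\<lambda>c. a *\<^sub>R \<xi> c + b *\<^sub>R \<eta> c) = a * \<alpha> \<xi> + b * \<alpha> \<eta>) \<and>
          (\<forall>\<xi>. \<xi> \<notin> tangent_space A x \<longrightarrow> \<alpha> \<xi> = 0)}"

definition cotangent_chart :: "('m, 'e::real_normed_vector) chart set \<Rightarrow> ('m, 'e) chart \<Rightarrow>
    ('m \<times> ('m, 'e) covec, 'e \<times> ('e \<Rightarrow>\<^sub>L real)) chart" where
  "cotangent_chart A c =
     ({(x, \<alpha>). x \<in> chart_dom c \<and> \<alpha> \<in> cotangent_space A x},
      \<lambda>(x, \<alpha>). (chart_map c x, Blinfun (\<lambda>u. \<alpha> (coord_vector A c x u))))"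

definition cotangent_bundle :: "('m, 'e::real_normed_vector) chart set \<Rightarrow>
    ('m \<times> ('m, 'e) covec, 'e \<times> ('e \<Rightarrow>\<^sub>L real)) chart set" where
  "cotangent_bundle A = cotangent_chart A ` A"

text \<open>The tangent map of g from the manifold A to the manifold B; by the chain rule the chart c
  around x may be chosen arbitrarily.\<close>

definition tangent_map :: "('m, 'e::real_normed_vector) chart set \<Rightarrow>
    ('k, 'f::real_normed_vector) chart set \<Rightarrow> ('m \<Rightarrow> 'k) \<Rightarrow>
    'm \<times> ('m, 'e) tvec \<Rightarrow> 'k \<times> ('k, 'f) tvec" where
  "tangent_map A B g = (\<lambda>(x, \<xi>).
     (g x, \<lambda>d. if d \<in> charts_at B (g x)
        then let c = (SOME c. c \<in> charts_at A x) in
          frechet_derivative (chart_map d \<circ> g \<circ> chart_inv c) (at (chart_map c x)) (\<xi> c)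
        else 0))"

text \<open>
  A smooth 3-form.  Trilinearity and smoothness are both contained in the requirement that in
  each chart the form is given by a smooth field h of bounded trilinear forms.
\<close>

definition three_form :: "('m, 'e::real_normed_vector) chart set \<Rightarrow>
    ('m \<Rightarrow> ('m, 'e) tvec \<Rightarrow> ('m, 'e) tvec \<Rightarrow> ('m, 'e) tvec \<Rightarrow> real) \<Rightarrow> bool" where
  "three_form A H \<longleftrightarrow>
     (\<forall>x\<in>points A. \<forall>\<xi>\<in>tangent_space A x. \<forall>\<eta>\<in>tangent_space A x.
        H x \<xi> \<xi> \<eta> = 0 \<and> H x \<xi> \<eta> \<eta> = 0 \<and> H x \<xi> \<eta> \<xi> = 0) \<and>
     (\<forall>c\<in>A. \<exists>h :: 'e \<Rightarrow> 'e \<Rightarrow>\<^sub>L 'e \<Rightarrow>\<^sub>L 'e \<Rightarrow>\<^sub>L real. smooth_on (chart_map c ` chart_dom c) h \<and>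
        (\<forall>x\<in>chart_dom c. \<forall>\<xi>\<in>tangent_space A x. \<forall>\<eta>\<in>tangent_space A x. \<forall>\<zeta>\<in>tangent_space A x.
           H x \<xi> \<eta> \<zeta> =
             blinfun_apply (blinfun_apply (blinfun_apply (h (chart_map c x)) (\<xi> c)) (\<eta> c)) (\<zeta> c)))"


section \<open>Simplices\<close>

text \<open>
  Spaces of coordinate vectors: Euclidean spaces whose standard basis is ordered, as
  \<open>vertex 1, \<dots>, vertex n\<close>; together with the origin these are the vertices of the standard
  simplex.  Iterated products of the reals are such spaces, e.g. real and
  real * real for n = 1, 2.
\<close>

class coordinate_space = euclidean_space +
  fixes vertex :: "nat \<Rightarrow> 'a"
  assumes vertex_0: "vertex 0 = 0"
    and vertex_Basis: "bij_betw vertex {1..DIM('a)} Basis"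

instantiation real :: coordinate_space
begin

definition vertex_real :: "nat \<Rightarrow> real" where "vertex_real k = real k"

instance
  by standard (simp_all add: vertex_real_def bij_betw_def)

end

instantiation prod :: (coordinate_space, coordinate_space) coordinate_space
begin

definition vertex_prod :: "nat \<Rightarrow> 'a \<times> 'b" where
  "vertex_prod k = (if k \<le> DIM('a) then (vertex k, 0) else (0, vertex (k - DIM('a))))"

instance
proof
  show "vertex 0 = (0 :: 'a \<times> 'b)"
    by (simp add: vertex_prod_def vertex_0 zero_prod_def)
  let ?m = "DIM('a)" and ?n = "DIM('b)"
  have 1: "bij_betw (vertex :: nat \<Rightarrow> 'a \<times> 'b) {1..?m} ((\<lambda>u. (u, 0)) ` Basis)"
  proof -
    have "bij_betw ((\<lambda>u. (u, 0 :: 'b)) \<circ> (vertex :: nat \<Rightarrow> 'a)) {1..?m} ((\<lambda>u. (u, 0)) ` Basis)"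
      by (rule bij_betw_trans[OF vertex_Basis]) (auto simp: bij_betw_def inj_on_def)
    then show ?thesis
      by (rule bij_betw_cong[THEN iffD1, rotated]) (auto simp: vertex_prod_def)
  qed
  have 2: "bij_betw (vertex :: nat \<Rightarrow> 'a \<times> 'b) {?m+1..?m+?n} ((\<lambda>v. (0, v)) ` Basis)"
  proof -
    have s: "bij_betw (\<lambda>k. k - ?m) {?m+1..?m+?n} {1..?n}"
      by (rule bij_betw_byWitness[where f' = "\<lambda>k. k + ?m"]) auto
    have "bij_betw ((\<lambda>v. (0 :: 'a, v)) \<circ> ((vertex :: nat \<Rightarrow> 'b) \<circ> (\<lambda>k. k - ?m)))
        {?m+1..?m+?n} ((\<lambda>v. (0, v)) ` Basis)"
      by (rule bij_betw_trans[OF bij_betw_trans[OF s vertex_Basis]])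
        (auto simp: bij_betw_def inj_on_def)
    then show ?thesis
      by (rule bij_betw_cong[THEN iffD1, rotated]) (auto simp: vertex_prod_def)
  qed
  have "bij_betw (vertex :: nat \<Rightarrow> 'a \<times> 'b) ({1..?m} \<union> {?m+1..?m+?n})
      ((\<lambda>u. (u, 0)) ` Basis \<union> (\<lambda>v. (0, v)) ` Basis)"
    by (rule bij_betw_combine[OF 1 2]) auto
  moreover have "{1..?m} \<union> {?m+1..?m+?n} = {1..DIM('a \<times> 'b)}"
    by auto
  ultimately show "bij_betw (vertex :: nat \<Rightarrow> 'a \<times> 'b) {1..DIM('a \<times> 'b)} Basis"
    by (simp add: Basis_prod_def)
qed

end

definition std_simplex :: "'v::coordinate_space set" where
  "std_simplex = convex hull (vertex ` {0..DIM('v)})"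

lemma std_simplex_real: "std_simplex = {0..1::real}"
proof -
  have "vertex ` {0..DIM(real)} = {0, 1::real}"
    by (auto simp: vertex_real_def image_iff intro: exI[of _ 0] exI[of _ 1])
  then show ?thesis
    by (simp add: std_simplex_def flip: segment_convex_hull) (simp add: closed_segment_eq_real_ivl)
qed

abbreviation simplex_tangent_bundle :: "('v::coordinate_space \<times> 'v) set" where
  "simplex_tangent_bundle \<equiv> std_simplex \<times> UNIV"

text \<open>The i-th coface is the affine map that enumerates the vertices other than the i-th one
  in increasing order; it is meant for dimension of 'w one more than that of 'v.\<close>

definition coface :: "nat \<Rightarrow> 'v::coordinate_space \<Rightarrow> 'w::coordinate_space" where
  "coface i s = (let V = (\<lambda>k. vertex (if k < i then k else Suc k)) in
     V 0 + (\<Sum>k = 1..DIM('v). (s \<bullet> vertex k) *\<^sub>R (V k - V 0)))"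

definition coface_tangent :: "nat \<Rightarrow> 'v::coordinate_space \<times> 'v \<Rightarrow> 'w::coordinate_space \<times> 'w" where
  "coface_tangent i = (\<lambda>(s, v). (coface i s, frechet_derivative (coface i) (at s) v))"


section \<open>The simplicial manifold of bundle maps\<close>

text \<open>Maps of class C^{p,q} from S into the vector bundle with total space E, base B
  and projection pr.\<close>

definition Cpq_map :: "nat \<Rightarrow> nat \<Rightarrow> 'a::real_normed_vector set \<Rightarrow>
    ('k, 'f::real_normed_vector) chart set \<Rightarrow> ('m, 'e::real_normed_vector) chart set \<Rightarrow>
    ('k \<Rightarrow> 'm) \<Rightarrow> ('a \<Rightarrow> 'k) \<Rightarrow> bool" where
  "Cpq_map p q S E B pr \<phi> \<longleftrightarrow> Ck_map q S E \<phi> \<and> Ck_map p S B (pr \<circ> \<phi>)"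

definition base_map :: "('v::coordinate_space \<times> 'v \<Rightarrow> 'm \<times> 'a) \<Rightarrow> 'v \<Rightarrow> 'm" where
  "base_map \<phi> s = fst (\<phi> (s, 0))"

definition bundle_maps :: "nat \<Rightarrow> nat \<Rightarrow> ('m, 'e::real_normed_vector) chart set \<Rightarrow>
    ('v::coordinate_space \<times> 'v \<Rightarrow> 'm \<times> ('m, 'e) covec) set" where
  "bundle_maps p q A =
     {\<phi>. Cpq_map p q simplex_tangent_bundle (cotangent_bundle A) A fst \<phi> \<and>
         (\<forall>s\<in>std_simplex. (\<forall>v. fst (\<phi> (s, v)) = base_map \<phi> s) \<and>
            (\<forall>\<xi>\<in>tangent_space A (base_map \<phi> s). linear (\<lambda>v. snd (\<phi> (s, v)) \<xi>)))}"

text \<open>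
  The second vector bundle structure of T(T*M), over TM, has as projection the tangent map of
  the projection of T*M.  In the chart ((x, a), (x', a')) of T(T*M) induced by a chart of M, the
  base coordinates are (x, x') and the linear fibre coordinates are (a, a').
\<close>

type_synonym ('m, 'e) tcovec = "('m \<times> ('m, 'e) covec, 'e \<times> ('e \<Rightarrow>\<^sub>L real)) tvec"

definition to_TM :: "('m, 'e::real_normed_vector) chart set \<Rightarrow>
    ('m \<times> ('m, 'e) covec) \<times> ('m, 'e) tcovec \<Rightarrow> 'm \<times> ('m, 'e) tvec" where
  "to_TM A = tangent_map (cotangent_bundle A) A fst"

definition fibre_coords :: "('m, 'e::real_normed_vector) chart set \<Rightarrow> ('m, 'e) chart \<Rightarrow>
    ('m \<times> ('m, 'e) covec) \<times> ('m, 'e) tcovec \<Rightarrow> ('e \<Rightarrow>\<^sub>L real) \<times> ('e \<Rightarrow>\<^sub>L real)" where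
  "fibre_coords A c z =
     (case chart_map (tangent_chart (cotangent_bundle A) (cotangent_chart A c)) z of
        ((x, a), (x', a')) \<Rightarrow> (a, a'))"

definition lift_base :: "('m, 'e::real_normed_vector) chart set \<Rightarrow>
    ('v::coordinate_space \<times> 'v \<Rightarrow> ('m \<times> ('m, 'e) covec) \<times> ('m, 'e) tcovec) \<Rightarrow>
    'v \<Rightarrow> 'm \<times> ('m, 'e) tvec" where
  "lift_base A X s = to_TM A (X (s, 0))"

text \<open>The base map of X is automatically of class C^p and covers the base map of \<open>\<phi>\<close>.\<close>

definition bundle_map_tangents :: "nat \<Rightarrow> nat \<Rightarrow> ('m, 'e::real_normed_vector) chart set \<Rightarrow>
    ('v::coordinate_space \<times> 'v \<Rightarrow> 'm \<times> ('m, 'e) covec) \<Rightarrow>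
    ('v \<times> 'v \<Rightarrow> ('m \<times> ('m, 'e) covec) \<times> ('m, 'e) tcovec) set" where
  "bundle_map_tangents p q A \<phi> =
     {X. Cpq_map p q simplex_tangent_bundle (tangent_bundle (cotangent_bundle A)) (tangent_bundle A)
           (to_TM A) X \<and>
         (\<forall>z\<in>simplex_tangent_bundle. fst (X z) = \<phi> z) \<and>
         (\<forall>s\<in>std_simplex. (\<forall>v. to_TM A (X (s, v)) = lift_base A X s) \<and>
            (\<forall>c\<in>charts_at A (base_map \<phi> s). linear (\<lambda>v. fibre_coords A c (X (s, v)))))}"

text \<open>The face maps; precomposition also gives their differentials on tangent vectors X.\<close>

definition face :: "nat \<Rightarrow> ('w::coordinate_space \<times> 'w \<Rightarrow> 'k) \<Rightarrow> 'v::coordinate_space \<times> 'v \<Rightarrow> 'k" where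
  "face i \<phi> = \<phi> \<circ> coface_tangent i"

type_synonym ('v, 'm, 'e) two_form =
  "('v \<times> 'v \<Rightarrow> 'm \<times> ('m, 'e) covec) \<Rightarrow>
   ('v \<times> 'v \<Rightarrow> ('m \<times> ('m, 'e) covec) \<times> ('m, 'e) tcovec) \<Rightarrow>
   ('v \<times> 'v \<Rightarrow> ('m \<times> ('m, 'e) covec) \<times> ('m, 'e) tcovec) \<Rightarrow> real"

definition face_pullback :: "nat \<Rightarrow> ('v::coordinate_space, 'm, 'e::real_normed_vector) two_form \<Rightarrow>
    ('w::coordinate_space, 'm, 'e) two_form" where
  "face_pullback i \<alpha> \<phi> X Y = \<alpha> (face i \<phi>) (face i X) (face i Y)"

text \<open>The sum runs over \<open>0, \<dots>, n + 1\<close>, where n is the dimension of 'v and n + 1 that of 'w.\<close>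

definition coboundary :: "('v::coordinate_space, 'm, 'e::real_normed_vector) two_form \<Rightarrow>
    ('w::coordinate_space, 'm, 'e) two_form" where
  "coboundary \<alpha> \<phi> X Y = (\<Sum>i = 0..DIM('v) + 1. (-1) ^ i * face_pullback i \<alpha> \<phi> X Y)"


section \<open>The two-forms\<close>

definition simplex_tangent_map :: "('m, 'e::real_normed_vector) chart set \<Rightarrow>
    ('v::coordinate_space \<Rightarrow> 'm) \<Rightarrow> 'v \<times> 'v \<Rightarrow> 'm \<times> ('m, 'e) tvec" where
  "simplex_tangent_map A f = (\<lambda>(s, v).
     (f s, \<lambda>d. if d \<in> charts_at A (f s)
        then frechet_derivative (chart_map d \<circ> f) (at s within std_simplex) v else 0))"

definition H_form :: "('m, 'e::real_normed_vector) chart set \<Rightarrow>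
    ('m \<Rightarrow> ('m, 'e) tvec \<Rightarrow> ('m, 'e) tvec \<Rightarrow> ('m, 'e) tvec \<Rightarrow> real) \<Rightarrow>
    ('v::coordinate_space \<times> 'v \<Rightarrow> 'm \<times> ('m, 'e) covec) \<Rightarrow>
    ('v \<times> 'v \<Rightarrow> ('m \<times> ('m, 'e) covec) \<times> ('m, 'e) tcovec) \<Rightarrow>
    ('v \<times> 'v \<Rightarrow> ('m \<times> ('m, 'e) covec) \<times> ('m, 'e) tcovec) \<Rightarrow> 'v \<Rightarrow> 'v \<Rightarrow> real" where
  "H_form A H \<phi> X Y s v =
     H (base_map \<phi> s) (snd (lift_base A X s)) (snd (lift_base A Y s))
       (snd (simplex_tangent_map A (base_map \<phi>) (s, v)))"

definition phi1 :: "('m, 'e::real_normed_vector) chart set \<Rightarrow>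
    ('m \<Rightarrow> ('m, 'e) tvec \<Rightarrow> ('m, 'e) tvec \<Rightarrow> ('m, 'e) tvec \<Rightarrow> real) \<Rightarrow> (real, 'm, 'e) two_form" where
  "phi1 A H \<phi> X Y = integral std_simplex (\<lambda>s. H_form A H \<phi> X Y s 1)"

definition ext_deriv :: "('v::coordinate_space \<Rightarrow> 'v \<Rightarrow> real) \<Rightarrow> 'v \<Rightarrow> 'v \<Rightarrow> 'v \<Rightarrow> real" where
  "ext_deriv \<omega> s u v =
     frechet_derivative (\<lambda>t. \<omega> t v) (at s within std_simplex) u -
     frechet_derivative (\<lambda>t. \<omega> t u) (at s within std_simplex) v"

definition segment_integral :: "('v::coordinate_space \<Rightarrow> 'v \<Rightarrow> real) \<Rightarrow> 'v \<Rightarrow> 'v \<Rightarrow> real" where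
  "segment_integral \<omega> a b = integral {0..1} (\<lambda>t. \<omega> (linepath a b t) (b - a))"

text \<open>The induced orientation of the boundary of the triangle is counterclockwise.\<close>

definition triangle_boundary_integral :: "(real \<times> real \<Rightarrow> real \<times> real \<Rightarrow> real) \<Rightarrow> real" where
  "triangle_boundary_integral \<omega> =
     segment_integral \<omega> (0, 0) (1, 0) + segment_integral \<omega> (1, 0) (0, 1) +
     segment_integral \<omega> (0, 1) (0, 0)"

text \<open>The 1-form on the triangle is of class C^{p-1}, hence has an exterior derivative
  if p is at least 2; for p = 1 the boundary integral is the definition.\<close>

definition phi2 :: "nat \<Rightarrow> ('m, 'e::real_normed_vector) chart set \<Rightarrow>
    ('m \<Rightarrow> ('m, 'e) tvec \<Rightarrow> ('m, 'e) tvec \<Rightarrow> ('m, 'e) tvec \<Rightarrow> real) \<Rightarrow>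
    (real \<times> real, 'm, 'e) two_form" where
  "phi2 p A H \<phi> X Y =
     (if 2 \<le> p then integral std_simplex (\<lambda>s. ext_deriv (H_form A H \<phi> X Y) s (1, 0) (0, 1))
      else triangle_boundary_integral (H_form A H \<phi> X Y))"

end

theory Submission
  imports Defs
begin

text \<open>
  The boundary of the triangle is the alternating sum of its three edges, which the cofaces
  parametrise affinely.  By the chain rule the 1-form of the restrictions of X and Y to the i-th
  edge is the pullback of the 1-form on the triangle, so the coboundary of \<open>phi1\<close> is the boundary
  integral.  For p = 1 this is the definition of \<open>phi2\<close>; for p at least 2 the 1-form is
  continuously differentiable up to the boundary, and Green's theorem on the triangle applies.
\<close>

section \<open>Derivatives within simplices\<close>

text \<open>Two obstacles shape the proof. The definitions evaluate
  \<open>frechet_derivative\<close>, a choice among possible derivatives, also at the edges and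
  corners of the simplex; so each chain rule computation has to end with uniqueness of the
  derivative within a convex set with nonempty interior. And a chart sees only the preimage of its
  domain, which is relatively open in the simplex but need not be convex; so derivatives are
  produced on such pieces and carried over to the whole simplex, where uniqueness is available. The
  bound p \<ge> 2 comes from the coordinate expression h(f)(X)(Y)(Df v) of the 1-form: h(f), X and Y
  are of class C^p, but Df v only of class C^{p-1}.\<close>

lemma std_simplex_eq_hull_Basis: "(std_simplex :: 'v::coordinate_space set) = convex hull (insert 0 Basis)"
proof -
  have "{0..DIM('v)} = insert 0 {1..DIM('v)}"
    by auto
  moreover have "vertex ` {1..DIM('v)} = (Basis :: 'v set)"
    using vertex_Basis[where 'a='v] by (simp add: bij_betw_def)
  ultimately show ?thesis
    by (simp add: std_simplex_def vertex_0)
qed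

lemma convex_std_simplex: "convex std_simplex"
  by (simp add: std_simplex_def)

lemma compact_std_simplex: "compact std_simplex"
  unfolding std_simplex_def by (intro finite_imp_compact_convex_hull) auto

lemma interior_std_simplex_nonempty: "interior (std_simplex :: 'v::coordinate_space set) \<noteq> {}"
  by (metis Starlike.interior_std_simplex_nonempty empty_iff std_simplex_eq_hull_Basis)

lemma std_simplex_triangle:
  "(std_simplex :: (real \<times> real) set) = {(x, y). 0 \<le> x \<and> 0 \<le> y \<and> x + y \<le> 1}"
  unfolding std_simplex_eq_hull_Basis std_simplex
  by (auto simp: Basis_prod_def inner_prod_def sum.union_disjoint)

text \<open>
  The library's criterion for unique derivatives within a set asks for points of the set in every
  axis direction, which fails at the vertices of a triangle.
\<close>

lemma has_derivative_unique_within_convex: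
  fixes f :: "'a::real_normed_vector \<Rightarrow> 'b::real_normed_vector"
  assumes S: "convex S" "interior S \<noteq> {}" and x: "x \<in> S"
    and F: "(f has_derivative F) (at x within S)"
    and G: "(f has_derivative G) (at x within S)"
  shows "F = G"
proof -
  interpret F: bounded_linear F using F by (rule has_derivative_bounded_linear)
  interpret G: bounded_linear G using G by (rule has_derivative_bounded_linear)
  \<comment> \<open>The segment from x to y stays in S, and along it both values are the one-sided
    derivative at 0 of the same function on the unit interval.\<close>
  have eq: "F (y - x) = G (y - x)" if y: "y \<in> S" for y
  proof -
    define l where "l = (\<lambda>t. x + t *\<^sub>R (y - x))"
    have l: "(l has_derivative (\<lambda>t. t *\<^sub>R (y - x))) (at 0 within {0..1})"
      unfolding l_def by (auto intro!: derivative_eq_intros)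
    have "l ` {0..1} \<subseteq> S"
    proof clarify
      fix t :: real assume "t \<in> {0..1}"
      then have "(1 - t) *\<^sub>R x + t *\<^sub>R y \<in> S"
        using \<open>convex S\<close> x y by (simp add: convex_alt)
      then show "l t \<in> S" by (simp add: l_def algebra_simps)
    qed
    then have sub: "(f has_derivative F) (at (l 0) within l ` {0..1})"
      "(f has_derivative G) (at (l 0) within l ` {0..1})"
      using F G by (auto simp: l_def intro: has_derivative_subset)
    have "((\<lambda>t. f (l t)) has_vector_derivative F (y - x)) (at 0 within {0..1})"
      "((\<lambda>t. f (l t)) has_vector_derivative G (y - x)) (at 0 within {0..1})"
      using has_derivative_in_compose[OF l sub(1)] has_derivative_in_compose[OF l sub(2)]
      by (simp_all add: has_vector_derivative_def F.scaleR G.scaleR)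
    then show ?thesis
      by (intro vector_derivative_unique_within_closed_interval[of 0 1 0]) auto
  qed
  \<comment> \<open>A multiple of any v is a difference of two admissible directions: subtracting z
    - x from (z + r v) - x cancels the base point. The summand 1 in r covers v = 0.\<close>
  obtain z e where e: "e > 0" "ball z e \<subseteq> S"
    using S(2) by (meson equals0I interior_subset mem_interior)
  show "F = G"
  proof
    fix v :: 'a
    define r where "r = e / (2 * (norm v + 1))"
    have "norm v + 1 > 0" by (simp add: add_nonneg_pos)
    then have r: "r > 0" and "r * (norm v + 1) = e / 2"
      using e(1) unfolding r_def by (simp, simp add: field_simps)
    then have "r * norm v < e" using e(1) by (simp add: distrib_left)
    then have "z + r *\<^sub>R v \<in> S" "z \<in> S"
      using e r by (auto simp: dist_norm subset_iff)
    then have "F (z + r *\<^sub>R v - x) - F (z - x) = G (z + r *\<^sub>R v - x) - G (z - x)"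
      by (simp only: eq)
    then have "F (r *\<^sub>R v) = G (r *\<^sub>R v)"
      by (simp add: F.add F.diff G.add G.diff)
    then show "F v = G v"
      using r by (simp add: F.scaleR G.scaleR)
  qed
qed

text \<open>Uniqueness is what turns a derivative that has been exhibited into the value of the
  choice operator.\<close>

lemma frechet_derivative_within_convex:
  assumes "convex S" "interior S \<noteq> {}" "x \<in> S" "(f has_derivative F) (at x within S)"
  shows "frechet_derivative f (at x within S) = F"
  using assms frechet_derivative_works
  by (metis differentiableI has_derivative_unique_within_convex)

lemmas frechet_derivative_within_simplex =
  frechet_derivative_within_convex[OF convex_std_simplex interior_std_simplex_nonempty]

section \<open>Relatively open pieces and maps of class C^1\<close>

lemma at_within_openin:
  assumes "openin (top_of_set S) U" "x \<in> U"
  shows "at x within U = at x within S"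
proof -
  obtain T where T: "open T" "U = S \<inter> T"
    using assms(1) by (auto simp: openin_open)
  show ?thesis
    by (rule at_within_nhd[of x T]) (use T assms(2) in auto)
qed

text \<open>Continuity is asked of each directional derivative separately, not of a
  \<open>blinfun\<close>-valued map. This is all that Green's theorem integrates, and it can be
  checked for \<open>frechet_derivative\<close> itself, which makes local statements easy to
  glue.\<close>

definition C1_on :: "'a::real_normed_vector set \<Rightarrow> ('a \<Rightarrow> 'b::real_normed_vector) \<Rightarrow> bool" where
  "C1_on S f \<longleftrightarrow> (\<exists>f'. (\<forall>x\<in>S. (f has_derivative f' x) (at x within S)) \<and>
     (\<forall>v. continuous_on S (\<lambda>x. f' x v)))"

lemma C1_on_frechet_derivative:
  assumes "C1_on S f" "convex S" "interior S \<noteq> {}"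
  shows "x \<in> S \<Longrightarrow> (f has_derivative frechet_derivative f (at x within S)) (at x within S)"
    and "continuous_on S (\<lambda>x. frechet_derivative f (at x within S) v)"
proof -
  obtain f' where f': "\<And>x. x \<in> S \<Longrightarrow> (f has_derivative f' x) (at x within S)"
    "\<And>v. continuous_on S (\<lambda>x. f' x v)"
    using assms(1) unfolding C1_on_def by metis
  have eq: "frechet_derivative f (at x within S) = f' x" if "x \<in> S" for x
    by (rule frechet_derivative_within_convex[OF assms(2,3) that f'(1)[OF that]])
  show "x \<in> S \<Longrightarrow> (f has_derivative frechet_derivative f (at x within S)) (at x within S)"
    using eq f' by simp
  show "continuous_on S (\<lambda>x. frechet_derivative f (at x within S) v)"
    by (rule continuous_on_eq[OF f'(2)[of v]]) (simp add: eq)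
qed

text \<open>The derivatives chosen on overlapping pieces might differ a priori. Each of them is the
  unique derivative within S, so \<open>frechet_derivative\<close> within S is a common choice, and
  its continuity is a local matter.\<close>

lemma C1_on_openin_cover:
  fixes f :: "'a::real_normed_vector \<Rightarrow> 'b::real_normed_vector"
  assumes S: "convex S" "interior S \<noteq> {}"
    and cover: "\<And>x. x \<in> S \<Longrightarrow> \<exists>U. openin (top_of_set S) U \<and> x \<in> U \<and> C1_on U f"
  shows "C1_on S f"
proof -
  let ?D = "\<lambda>x. frechet_derivative f (at x within S)"
  have D: "(f has_derivative ?D x) (at x within S) \<and> continuous (at x within S) (\<lambda>x. ?D x v)"
    if x: "x \<in> S" for x v
  proof -
    obtain U f' where U: "openin (top_of_set S) U" "x \<in> U"
      and f': "\<And>y. y \<in> U \<Longrightarrow> (f has_derivative f' y) (at y within U)" "\<And>v. continuous_on U (\<lambda>y. f' y v)"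
      using cover[OF x] unfolding C1_on_def by metis
    have at: "at y within U = at y within S" if "y \<in> U" for y
      using U(1) that by (rule at_within_openin)
    have eq: "?D y = f' y" if "y \<in> U" for y
    proof (rule frechet_derivative_within_convex[OF S])
      show "y \<in> S" using openin_imp_subset[OF U(1)] that by auto
      show "(f has_derivative f' y) (at y within S)" using f'(1)[OF that] at[OF that] by simp
    qed
    have "continuous_on U (\<lambda>y. ?D y v)"
      by (rule continuous_on_eq[OF f'(2)[of v]]) (simp add: eq)
    then show ?thesis
      using f'(1)[OF U(2)] at[OF U(2)] eq[OF U(2)] U(2)
      by (auto simp: continuous_on_eq_continuous_within)
  qed
  then show ?thesis
    unfolding C1_on_def continuous_on_eq_continuous_within by (intro exI[of _ ?D]) auto
qed

lemma C1_on_blinfun_apply: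
  assumes F: "C1_on S F" and g: "C1_on S g"
  shows "C1_on S (\<lambda>x. blinfun_apply (F x) (g x))"
proof -
  obtain F' where F': "\<And>x. x \<in> S \<Longrightarrow> (F has_derivative F' x) (at x within S)"
    "\<And>v. continuous_on S (\<lambda>x. F' x v)"
    using F unfolding C1_on_def by metis
  obtain g' where g': "\<And>x. x \<in> S \<Longrightarrow> (g has_derivative g' x) (at x within S)"
    "\<And>v. continuous_on S (\<lambda>x. g' x v)"
    using g unfolding C1_on_def by metis
  have "continuous_on S F" "continuous_on S g"
    using has_derivative_continuous_on[OF F'(1)] has_derivative_continuous_on[OF g'(1)] by auto
  then have "continuous_on S (\<lambda>x. blinfun_apply (F x) (g' x v) + blinfun_apply (F' x v) (g x))" for v
    by (intro continuous_on_add blinfun.continuous_on[OF _ g'(2)] blinfun.continuous_on[OF F'(2)])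
  then show ?thesis
    unfolding C1_on_def using F'(1) g'(1)
    by (intro exI[of _ "\<lambda>x v. blinfun_apply (F x) (g' x v) + blinfun_apply (F' x v) (g x)"])
      (auto intro: blinfun.FDERIV)
qed

lemma C1_on_compose_open:
  assumes h: "smooth_on U h" "open U" and f: "C1_on S f" and sub: "f ` S \<subseteq> U"
  shows "C1_on S (\<lambda>x. h (f x))"
proof -
  have "Ck_on (Suc 0) U h"
    using h(1) by (simp only: smooth_on_def)
  then obtain h' where h': "continuous_on U h'"
    "\<And>x. x \<in> U \<Longrightarrow> (h has_derivative blinfun_apply (h' x)) (at x within U)"
    by auto
  obtain f' where f': "\<And>x. x \<in> S \<Longrightarrow> (f has_derivative f' x) (at x within S)"
    "\<And>v. continuous_on S (\<lambda>x. f' x v)"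
    using f unfolding C1_on_def by metis
  have "((\<lambda>x. h (f x)) has_derivative (\<lambda>v. blinfun_apply (h' (f x)) (f' x v))) (at x within S)"
    if "x \<in> S" for x
    by (rule has_derivative_compose[OF f'(1)[OF that]])
      (use h'(2)[of "f x"] at_within_open[OF _ h(2), of "f x"] sub that in auto)
  moreover have "continuous_on S (\<lambda>x. h' (f x))"
    by (rule continuous_on_compose2[OF h'(1) has_derivative_continuous_on[OF f'(1)] sub])
  then have "continuous_on S (\<lambda>x. blinfun_apply (h' (f x)) (f' x v))" for v
    by (rule blinfun.continuous_on[OF _ f'(2)])
  ultimately show ?thesis
    unfolding C1_on_def by (intro exI[of _ "\<lambda>x v. blinfun_apply (h' (f x)) (f' x v)"]) auto
qed

lemma C1_on_cong:
  assumes "C1_on S f" "\<And>x. x \<in> S \<Longrightarrow> f x = g x"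
  shows "C1_on S g"
proof -
  obtain f' where f': "\<And>x. x \<in> S \<Longrightarrow> (f has_derivative f' x) (at x within S)"
    "\<And>v. continuous_on S (\<lambda>x. f' x v)"
    using assms(1) unfolding C1_on_def by metis
  have "(g has_derivative f' x) (at x within S)" if "x \<in> S" for x
    by (rule has_derivative_transform[OF that _ f'(1)[OF that]]) (simp add: assms(2))
  then show ?thesis
    using f'(2) unfolding C1_on_def by blast
qed

lemma C1_on_snd:
  assumes "C1_on S f"
  shows "C1_on S (\<lambda>x. snd (f x))"
proof -
  obtain f' where "\<And>x. x \<in> S \<Longrightarrow> (f has_derivative f' x) (at x within S)"
    "\<And>v. continuous_on S (\<lambda>x. f' x v)"
    using assms unfolding C1_on_def by metis
  then show ?thesis
    unfolding C1_on_def by (intro exI[of _ "\<lambda>x v. snd (f' x v)"])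
      (auto intro: has_derivative_snd continuous_on_snd)
qed

section \<open>Green's theorem on the triangle\<close>

text \<open>Fubini's theorem for g extended by 0 to the plane. Both orders are needed, because
  Green's theorem differentiates one coefficient vertically and the other horizontally.\<close>

lemma integral_triangle:
  fixes g :: "real \<times> real \<Rightarrow> real"
  assumes g: "continuous_on std_simplex g"
  shows "integral std_simplex g = integral {0..1} (\<lambda>x. integral {0..1-x} (\<lambda>y. g (x, y)))"
    and "integral std_simplex g = integral {0..1} (\<lambda>y. integral {0..1-y} (\<lambda>x. g (x, y)))"
proof -
  let ?T = "std_simplex :: (real \<times> real) set"
  let ?G = "\<lambda>z. indicator ?T z *\<^sub>R g z"
  have int: "integrable lborel ?G"
    by (rule borel_integrable_compact[OF compact_std_simplex g])
  then have I: "integrable (lborel \<Otimes>\<^sub>M lborel) ?G"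
    by (simp add: lborel_prod)
  have tot: "integral ?T g = integral\<^sup>L (lborel \<Otimes>\<^sub>M lborel) ?G"
    using set_borel_integral_eq_integral(2)[of ?T g] int
    by (simp add: set_integrable_def set_lebesgue_integral_def lborel_prod)
  \<comment> \<open>For x < 0 nothing is known about g on the slice, but there the outer indicator
    vanishes; for x > 1 the interval is empty.\<close>
  have x1: "(LINT y|lborel. ?G (x, y)) = indicator {0..1} x *\<^sub>R integral {0..1-x} (\<lambda>y. g (x, y))" for x
  proof -
    have "continuous_on {0..1-x} (\<lambda>y. g (x, y))" if "x \<ge> 0"
      by (rule continuous_on_compose2[OF g]) (use that in \<open>auto simp: std_simplex_triangle intro!: continuous_intros\<close>)
    then have c: "set_integrable lborel {0..1-x} (\<lambda>y. g (x, y))" if "x \<ge> 0"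
      unfolding set_integrable_def using that by (intro borel_integrable_compact) auto
    have "?G (x, y) = indicator {0..1} x *\<^sub>R (indicator {0..1-x} y *\<^sub>R g (x, y))" for y
      by (auto simp: std_simplex_triangle indicator_def)
    then have "(LINT y|lborel. ?G (x, y)) = indicator {0..1} x *\<^sub>R (LINT y:{0..1-x}|lborel. g (x, y))"
      by (simp only: set_lebesgue_integral_def integral_scaleR_right)
    then show ?thesis
      using c set_borel_integral_eq_integral(2) by (auto simp: indicator_def)
  qed
  have x2: "(LINT x|lborel. ?G (x, y)) = indicator {0..1} y *\<^sub>R integral {0..1-y} (\<lambda>x. g (x, y))" for y
  proof -
    have "continuous_on {0..1-y} (\<lambda>x. g (x, y))" if "y \<ge> 0"
      by (rule continuous_on_compose2[OF g]) (use that in \<open>auto simp: std_simplex_triangle intro!: continuous_intros\<close>)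
    then have c: "set_integrable lborel {0..1-y} (\<lambda>x. g (x, y))" if "y \<ge> 0"
      unfolding set_integrable_def using that by (intro borel_integrable_compact) auto
    have "?G (x, y) = indicator {0..1} y *\<^sub>R (indicator {0..1-y} x *\<^sub>R g (x, y))" for x
      by (auto simp: std_simplex_triangle indicator_def)
    then have "(LINT x|lborel. ?G (x, y)) = indicator {0..1} y *\<^sub>R (LINT x:{0..1-y}|lborel. g (x, y))"
      by (simp only: set_lebesgue_integral_def integral_scaleR_right)
    then show ?thesis
      using c set_borel_integral_eq_integral(2) by (auto simp: indicator_def)
  qed
  \<comment> \<open>Fubini also yields integrability of the inner integral in x, which is what the
    passage from the Lebesgue to the gauge integral requires.\<close>
  have "set_integrable lborel {0..1} (\<lambda>x. integral {0..1-x} (\<lambda>y. g (x, y)))"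
    using lborel_pair.integrable_fst'[OF I] by (simp only: x1 set_integrable_def)
  from set_borel_integral_eq_integral(2)[OF this] lborel_pair.integral_fst'[OF I]
  show "integral ?T g = integral {0..1} (\<lambda>x. integral {0..1-x} (\<lambda>y. g (x, y)))"
    by (simp only: x1 tot set_lebesgue_integral_def)
  have I': "integrable (lborel \<Otimes>\<^sub>M lborel) (case_prod (\<lambda>x y. ?G (x, y)))"
    using I by (simp only: case_prod_beta' prod.collapse)
  have "set_integrable lborel {0..1} (\<lambda>y. integral {0..1-y} (\<lambda>x. g (x, y)))"
    using lborel_pair.integrable_snd[OF I'] by (simp only: x2 set_integrable_def)
  from set_borel_integral_eq_integral(2)[OF this] lborel_pair.integral_snd[OF I']
  show "integral ?T g = integral {0..1} (\<lambda>y. integral {0..1-y} (\<lambda>x. g (x, y)))"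
    by (simp only: x2 tot set_lebesgue_integral_def) (simp add: case_prod_beta')
qed

text \<open>Reflection is an involution, so f and its reflection have the same
  \<open>has_integral\<close> values. Hence the equation holds even without integrability, where
  both sides are the same default value, and none has to be supplied for the edges when p =
  1.\<close>

lemma integral_unit_reflect:
  fixes f :: "real \<Rightarrow> real"
  shows "integral {0..1} (\<lambda>t. f (1 - t)) = integral {0..1} f"
proof -
  have *: "((\<lambda>t. f (1 - t)) has_integral i) {0..1}" if "(f has_integral i) {0..1}" for f :: "real \<Rightarrow> real" and i
    using has_integral_affinity[of f i 0 1 "-1" 1] that by (simp add: image_affinity_atLeastAtMost)
  then have "((\<lambda>t. f (1 - t)) has_integral i) {0..1} \<longleftrightarrow> (f has_integral i) {0..1}" for i
    using *[of "\<lambda>t. f (1 - t)" i] by auto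
  then show ?thesis
    by (simp add: integral_def integrable_on_def)
qed

text \<open>P and Q are the coefficients of the form P dx + Q dy. The fundamental theorem of
  calculus on vertical slices for P and on horizontal slices for Q leaves values on the two legs
  and, from both, on the hypotenuse with tangent (-1, 1).\<close>

lemma green_triangle:
  fixes P Q :: "real \<times> real \<Rightarrow> real"
  assumes P: "C1_on std_simplex P" and Q: "C1_on std_simplex Q"
  shows "integral std_simplex (\<lambda>s. frechet_derivative Q (at s within std_simplex) (1, 0) -
      frechet_derivative P (at s within std_simplex) (0, 1)) =
    integral {0..1} (\<lambda>t. P (t, 0)) + integral {0..1} (\<lambda>t. Q (1 - t, t) - P (1 - t, t)) -
    integral {0..1} (\<lambda>t. Q (0, t))"
proof -
  let ?T = "std_simplex :: (real \<times> real) set"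
  let ?P = "\<lambda>s. frechet_derivative P (at s within ?T)"
  let ?Q = "\<lambda>s. frechet_derivative Q (at s within ?T)"
  note C1 = C1_on_frechet_derivative[OF _ convex_std_simplex interior_std_simplex_nonempty]
  have contPQ: "continuous_on ?T P" "continuous_on ?T Q"
    by (rule has_derivative_continuous_on[OF C1(1)[OF P]], assumption, rule has_derivative_continuous_on[OF C1(1)[OF Q]])
  have P': "integral {0..1-x} (\<lambda>y. ?P (x, y) (0, 1)) = P (x, 1 - x) - P (x, 0)"
    if x: "x \<in> {0..1}" for x
  proof (rule integral_unique, rule fundamental_theorem_of_calculus)
    fix y assume y: "y \<in> {0..1-x}"
    have l: "((\<lambda>y. (x, y)) has_vector_derivative (0, 1)) (at y within {0..1-x})"
      unfolding has_vector_derivative_def by (auto intro!: derivative_eq_intros has_derivative_Pair)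
    have "(P has_derivative ?P (x, y)) (at (x, y) within (\<lambda>y. (x, y)) ` {0..1-x})"
      by (rule has_derivative_subset[OF C1(1)[OF P]]) (use x y in \<open>auto simp: std_simplex_triangle\<close>)
    from vector_derivative_diff_chain_within[OF l this]
    show "((\<lambda>y. P (x, y)) has_vector_derivative ?P (x, y) (0, 1)) (at y within {0..1-x})"
      by (simp add: o_def)
  qed (use x in auto)
  have Q': "integral {0..1-y} (\<lambda>x. ?Q (x, y) (1, 0)) = Q (1 - y, y) - Q (0, y)"
    if y: "y \<in> {0..1}" for y
  proof (rule integral_unique, rule fundamental_theorem_of_calculus)
    fix x assume x: "x \<in> {0..1-y}"
    have l: "((\<lambda>x. (x, y)) has_vector_derivative (1, 0)) (at x within {0..1-y})"
      unfolding has_vector_derivative_def by (auto intro!: derivative_eq_intros has_derivative_Pair)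
    have "(Q has_derivative ?Q (x, y)) (at (x, y) within (\<lambda>x. (x, y)) ` {0..1-y})"
      by (rule has_derivative_subset[OF C1(1)[OF Q]]) (use x y in \<open>auto simp: std_simplex_triangle\<close>)
    from vector_derivative_diff_chain_within[OF l this]
    show "((\<lambda>x. Q (x, y)) has_vector_derivative ?Q (x, y) (1, 0)) (at x within {0..1-y})"
      by (simp add: o_def)
  qed (use y in auto)
  have edge: "(\<lambda>t. R (t, 0)) integrable_on {0..1}" "(\<lambda>t. R (0, t)) integrable_on {0..1}"
      "(\<lambda>t. R (1 - t, t)) integrable_on {0..1}" "(\<lambda>t. R (t, 1 - t)) integrable_on {0..1}"
    if "continuous_on ?T R" for R :: "real \<times> real \<Rightarrow> real"
    by (rule integrable_continuous_real, rule continuous_on_compose2[OF that],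
        intro continuous_intros, simp add: image_subset_iff std_simplex_triangle)+
  note int = edge[OF contPQ(1)] edge[OF contPQ(2)]
  have "integral ?T (\<lambda>s. ?Q s (1, 0) - ?P s (0, 1)) =
    integral ?T (\<lambda>s. ?Q s (1, 0)) - integral ?T (\<lambda>s. ?P s (0, 1))"
  proof (rule integral_diff)
    show "(\<lambda>s. ?Q s (1, 0)) integrable_on ?T" "(\<lambda>s. ?P s (0, 1)) integrable_on ?T"
      by (rule set_borel_integral_eq_integral(1), unfold set_integrable_def,
          rule borel_integrable_compact[OF compact_std_simplex C1(2)], rule P Q)+
  qed
  also have "integral ?T (\<lambda>s. ?P s (0, 1)) = integral {0..1} (\<lambda>x. P (x, 1 - x) - P (x, 0))"
    unfolding integral_triangle(1)[OF C1(2)[OF P]] by (rule integral_cong) (rule P')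
  also have "\<dots> = integral {0..1} (\<lambda>x. P (x, 1 - x)) - integral {0..1} (\<lambda>x. P (x, 0))"
    using int by (intro integral_diff)
  \<comment> \<open>The vertical slices run through the hypotenuse as (x, 1 - x), the horizontal
    ones as (1 - y, y); reflection brings both to the latter, counterclockwise
    parametrisation.\<close>
  also have "integral {0..1} (\<lambda>x. P (x, 1 - x)) = integral {0..1} (\<lambda>t. P (1 - t, t))"
    using integral_unit_reflect[of "\<lambda>t. P (1 - t, t)"] by simp
  also have "integral ?T (\<lambda>s. ?Q s (1, 0)) = integral {0..1} (\<lambda>y. Q (1 - y, y) - Q (0, y))"
    unfolding integral_triangle(2)[OF C1(2)[OF Q]] by (rule integral_cong) (rule Q')
  also have "\<dots> = integral {0..1} (\<lambda>y. Q (1 - y, y)) - integral {0..1} (\<lambda>y. Q (0, y))"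
    using int by (intro integral_diff)
  finally show ?thesis
    using int by (simp add: integral_diff)
qed

section \<open>Maps of class C^k\<close>

text \<open>For linear L the derivative of f o L in a fixed direction v is the derivative of f in
  the fixed direction L v, composed with L. The induction hypothesis applies to it directly, without
  a product rule.\<close>

lemma Ck_on_compose_linear:
  fixes f :: "'a::real_normed_vector \<Rightarrow> 'b::real_normed_vector"
    and L :: "'c::real_normed_vector \<Rightarrow> 'a"
  assumes L: "bounded_linear L" and sub: "L ` S \<subseteq> T"
  shows "Ck_on k T f \<Longrightarrow> Ck_on k S (f \<circ> L)"
proof (induction k arbitrary: f)
  case 0
  then show ?case
    using continuous_on_compose2[OF _ linear_continuous_on[OF L] sub] by (auto simp: o_def)
next
  case (Suc k)
  then obtain f' where f': "continuous_on T f'"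
    "\<And>x. x \<in> T \<Longrightarrow> (f has_derivative blinfun_apply (f' x)) (at x within T)"
    "\<And>v. Ck_on k T (\<lambda>x. blinfun_apply (f' x) v)"
    by auto
  define g' where "g' = (\<lambda>x. f' (L x) o\<^sub>L Blinfun L)"
  have g': "blinfun_apply (g' x) v = blinfun_apply (f' (L x)) (L v)" for x v
    by (simp add: g'_def bounded_linear_Blinfun_apply[OF L])
  have "continuous_on S (\<lambda>x. f' (L x))"
    by (rule continuous_on_compose2[OF f'(1) linear_continuous_on[OF L] sub])
  then have "continuous_on S g'"
    unfolding g'_def by (intro continuous_intros)
  moreover have "((f \<circ> L) has_derivative blinfun_apply (g' x)) (at x within S)" if "x \<in> S" for x
  proof -
    have "(f has_derivative blinfun_apply (f' (L x))) (at (L x) within L ` S)"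
      using f'(2) sub that by (meson has_derivative_subset image_subset_iff)
    from diff_chain_within[OF bounded_linear_imp_has_derivative[OF L] this]
    moreover have "blinfun_apply (g' x) = blinfun_apply (f' (L x)) \<circ> L"
      by (simp add: fun_eq_iff g')
    ultimately show ?thesis by simp
  qed
  moreover have "Ck_on k S (\<lambda>x. blinfun_apply (g' x) v)" for v
    using Suc.IH[OF f'(3)[of "L v"]] by (simp add: g' o_def)
  ultimately show ?case
    unfolding Ck_on.simps by blast
qed

lemma Ck_map_compose_linear:
  assumes g: "Ck_map k T A g" and L: "bounded_linear L" and sub: "L ` S \<subseteq> T"
  shows "Ck_map k S A (g \<circ> L)"
proof -
  have "openin (top_of_set S) (S \<inter> (g \<circ> L) -` chart_dom c) \<and>
      Ck_on k (S \<inter> (g \<circ> L) -` chart_dom c) (chart_map c \<circ> (g \<circ> L))" if "c \<in> A" for c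
  proof
    have c: "openin (top_of_set T) (T \<inter> g -` chart_dom c)"
      "Ck_on k (T \<inter> g -` chart_dom c) (chart_map c \<circ> g)"
      using g that by (auto simp: Ck_map_def)
    have "openin (top_of_set S) (S \<inter> L -` (T \<inter> g -` chart_dom c))"
      by (rule continuous_openin_preimage[OF linear_continuous_on[OF L] _ c(1)]) (use sub in auto)
    moreover have "S \<inter> L -` (T \<inter> g -` chart_dom c) = S \<inter> (g \<circ> L) -` chart_dom c"
      using sub by auto
    ultimately show "openin (top_of_set S) (S \<inter> (g \<circ> L) -` chart_dom c)"
      by simp
    show "Ck_on k (S \<inter> (g \<circ> L) -` chart_dom c) (chart_map c \<circ> (g \<circ> L))"
      unfolding o_assoc by (rule Ck_on_compose_linear[OF L _ c(2)]) (use sub in auto)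
  qed
  moreover have "(g \<circ> L) ` S \<subseteq> points A"
    using g sub by (auto simp: Ck_map_def)
  ultimately show ?thesis
    by (simp add: Ck_map_def)
qed

lemma Ck_on_Suc_imp_C1_on:
  assumes "Ck_on (Suc k) S f"
  shows "C1_on S f"
proof -
  obtain f' where f': "continuous_on S f'"
    "\<And>x. x \<in> S \<Longrightarrow> (f has_derivative blinfun_apply (f' x)) (at x within S)"
    using assms by auto
  then show ?thesis
    unfolding C1_on_def
    by (intro exI[of _ "\<lambda>x. blinfun_apply (f' x)"]) (auto intro!: continuous_intros)
qed

section \<open>The 1-form of two tangent vectors\<close>

lemma bounded_linear_zero_section: "bounded_linear (\<lambda>s. (s, 0))"
  by (intro bounded_linear_Pair bounded_linear_ident bounded_linear_zero)

text \<open>\<open>base_map\<close> and \<open>lift_base\<close> are values on zero vectors, so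
  their regularity is inherited from the total space along the linear map s -> (s, 0).\<close>

lemma Ck_map_zero_section:
  assumes "Ck_map k (S \<times> UNIV) A g"
  shows "Ck_map k S A (\<lambda>s. g (s, 0))"
  using Ck_map_compose_linear[OF assms bounded_linear_zero_section, of S] by (auto simp: o_def)

lemma base_map_Ck:
  assumes "\<phi> \<in> bundle_maps p q A"
  shows "Ck_map p std_simplex A (base_map \<phi>)"
  using assms Ck_map_zero_section[of p std_simplex A "fst \<circ> \<phi>"]
  by (simp add: bundle_maps_def Cpq_map_def base_map_def[abs_def])

lemma lift_base_Ck:
  assumes "X \<in> bundle_map_tangents p q A \<phi>"
  shows "Ck_map p std_simplex (tangent_bundle A) (lift_base A X)"
  using assms Ck_map_zero_section[of p std_simplex "tangent_bundle A" "to_TM A \<circ> X"]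
  by (simp add: bundle_map_tangents_def Cpq_map_def lift_base_def[abs_def])

text \<open>Tangency is contained in the C^p condition, because
  \<open>points (tangent_bundle A)\<close> consists of pairs of a point and a tangent vector
  there.\<close>

lemma lift_base_tangent:
  assumes X: "X \<in> bundle_map_tangents p q A \<phi>" and s: "s \<in> std_simplex"
  shows "fst (lift_base A X s) = base_map \<phi> s"
    and "snd (lift_base A X s) \<in> tangent_space A (base_map \<phi> s)"
proof -
  have "fst (X (s, 0)) = \<phi> (s, 0)"
    using X s by (auto simp: bundle_map_tangents_def)
  then show *: "fst (lift_base A X s) = base_map \<phi> s"
    by (simp add: lift_base_def to_TM_def tangent_map_def base_map_def case_prod_beta)
  have "lift_base A X s \<in> points (tangent_bundle A)"
    using lift_base_Ck[OF X] s by (auto simp: Ck_map_def)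
  then have "snd (lift_base A X s) \<in> tangent_space A (fst (lift_base A X s))"
    by (auto simp: points_def tangent_bundle_def tangent_chart_def)
  then show "snd (lift_base A X s) \<in> tangent_space A (base_map \<phi> s)"
    by (simp add: *)
qed

lemma has_derivative_frechet_derivative:
  assumes "(f has_derivative D) F"
  shows "(f has_derivative frechet_derivative f F) F"
  unfolding frechet_derivative_works[symmetric] by (rule differentiableI[OF assms])

lemma Ck_map_chart_has_derivative:
  fixes f :: "'v::coordinate_space \<Rightarrow> 'm"
  assumes f: "Ck_map p std_simplex A f" and p: "p \<ge> 1"
    and s: "s \<in> std_simplex" and c: "c \<in> charts_at A (f s)"
  shows "((chart_map c \<circ> f) has_derivative
      frechet_derivative (chart_map c \<circ> f) (at s within std_simplex)) (at s within std_simplex)"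
proof -
  let ?U = "std_simplex \<inter> f -` chart_dom c"
  obtain k where k: "p = Suc k"
    using p by (cases p) auto
  have cA: "c \<in> A" and sU: "s \<in> ?U"
    using s c by (auto simp: charts_at_def)
  have U: "openin (top_of_set std_simplex) ?U" "Ck_on (Suc k) ?U (chart_map c \<circ> f)"
    using f cA by (auto simp: Ck_map_def k)
  obtain D where "((chart_map c \<circ> f) has_derivative D) (at s within ?U)"
    using Ck_on_Suc_imp_C1_on[OF U(2)] sU by (auto simp: C1_on_def)
  then have "((chart_map c \<circ> f) has_derivative D) (at s within std_simplex)"
    by (simp only: at_within_openin[OF U(1) sU])
  then show ?thesis
    by (rule has_derivative_frechet_derivative)
qed

lemma smooth_on_has_derivative:
  assumes "smooth_on U f" "open U" "x \<in> U"
  shows "(f has_derivative frechet_derivative f (at x)) (at x)"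
proof -
  have "Ck_on (Suc 0) U f"
    using assms(1) by (simp only: smooth_on_def)
  then obtain D where "(f has_derivative D) (at x within U)"
    using assms(3) by auto
  then have "(f has_derivative D) (at x)"
    by (simp only: at_within_open[OF assms(3,2)])
  then show ?thesis
    by (rule has_derivative_frechet_derivative)
qed

text \<open>\<open>three_form\<close> gives its coordinate formula only for tangent vectors, so the
  components of Tf(v) must be shown to be related by the transition maps. This is the chain
  rule.\<close>

lemma simplex_tangent_map_tangent_space:
  fixes f :: "'v::coordinate_space \<Rightarrow> 'm"
  assumes A: "smooth_atlas A" and f: "Ck_map p std_simplex A f" and p: "p \<ge> 1"
    and s: "s \<in> std_simplex"
  shows "snd (simplex_tangent_map A f (s, v)) \<in> tangent_space A (f s)"
proof -
  let ?D = "\<lambda>c. frechet_derivative (chart_map c \<circ> f) (at s within std_simplex)"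
  have rel: "?D d v = frechet_derivative (transition c d) (at (chart_map c (f s))) (?D c v)"
    if c: "c \<in> charts_at A (f s)" and d: "d \<in> charts_at A (f s)" for c d
  proof -
    let ?W = "chart_map c ` (chart_dom c \<inter> chart_dom d)"
    have cd: "c \<in> A" "d \<in> A" "f s \<in> chart_dom c" "f s \<in> chart_dom d"
      using c d by (auto simp: charts_at_def)
    have inj: "inj_on (chart_map c) (chart_dom c)"
      and W: "open ?W" "smooth_on ?W (transition c d)"
      using A cd by (simp_all add: smooth_atlas_def)
    have tr: "(transition c d has_derivative
        frechet_derivative (transition c d) (at (chart_map c (f s)))) (at (chart_map c (f s)))"
      by (rule smooth_on_has_derivative[OF W(2,1)]) (use cd in auto)
    have chain: "((\<lambda>t. transition c d ((chart_map c \<circ> f) t)) has_derivative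
        (\<lambda>v. frechet_derivative (transition c d) (at (chart_map c (f s))) (?D c v))) (at s within std_simplex)"
      by (rule has_derivative_compose[OF Ck_map_chart_has_derivative[OF f p s c]]) (simp add: tr)
    let ?U = "std_simplex \<inter> f -` chart_dom c"
    have "openin (top_of_set std_simplex) ?U"
      using f cd(1) by (auto simp: Ck_map_def)
    then have at: "at s within ?U = at s within std_simplex"
      using s cd(3) by (intro at_within_openin) auto
    \<comment> \<open>The factorisation of \<open>chart_map d \<circ> f\<close> through
      \<open>transition c d\<close> holds only on ?U, so the function is replaced within ?U before
      returning to the simplex.\<close>
    have "((chart_map d \<circ> f) has_derivative
        (\<lambda>v. frechet_derivative (transition c d) (at (chart_map c (f s))) (?D c v))) (at s within ?U)"
      by (rule has_derivative_transform[OF _ _ has_derivative_subset[OF chain Int_lower1]])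
        (use s cd(3) inj in \<open>auto simp: transition_def chart_inv_def\<close>)
    from frechet_derivative_within_simplex[OF s this[unfolded at]] show ?thesis
      by simp
  qed
  show ?thesis
    by (auto simp: tangent_space_def simplex_tangent_map_def intro: rel)
qed

text \<open>One field h serves for all s and v over the chart: linearity uses the formula at a fixed
  s, differentiability uses it as a function of s.\<close>

lemma H_form_chart:
  fixes A :: "('m, 'e::real_normed_vector) chart set" and \<phi> :: "'v::coordinate_space \<times> 'v \<Rightarrow> _"
  assumes A: "smooth_atlas A" and H: "three_form A H" and p: "p \<ge> 1"
    and \<phi>: "\<phi> \<in> bundle_maps p q A"
    and X: "X \<in> bundle_map_tangents p q A \<phi>" and Y: "Y \<in> bundle_map_tangents p q A \<phi>"
    and c: "c \<in> A"
  obtains h :: "'e \<Rightarrow> 'e \<Rightarrow>\<^sub>L 'e \<Rightarrow>\<^sub>L 'e \<Rightarrow>\<^sub>L real" where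
    "smooth_on (chart_map c ` chart_dom c) h"
    "\<And>s v. s \<in> std_simplex \<Longrightarrow> base_map \<phi> s \<in> chart_dom c \<Longrightarrow>
      H_form A H \<phi> X Y s v =
        blinfun_apply (blinfun_apply (blinfun_apply (h (chart_map c (base_map \<phi> s)))
          (snd (lift_base A X s) c)) (snd (lift_base A Y s) c))
          (frechet_derivative (chart_map c \<circ> base_map \<phi>) (at s within std_simplex) v)"
proof -
  obtain h :: "'e \<Rightarrow> 'e \<Rightarrow>\<^sub>L 'e \<Rightarrow>\<^sub>L 'e \<Rightarrow>\<^sub>L real" where h: "smooth_on (chart_map c ` chart_dom c) h"
    "\<And>x \<xi> \<eta> \<zeta>. x \<in> chart_dom c \<Longrightarrow> \<xi> \<in> tangent_space A x \<Longrightarrow> \<eta> \<in> tangent_space A x \<Longrightarrow>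
      \<zeta> \<in> tangent_space A x \<Longrightarrow> H x \<xi> \<eta> \<zeta> =
        blinfun_apply (blinfun_apply (blinfun_apply (h (chart_map c x)) (\<xi> c)) (\<eta> c)) (\<zeta> c)"
    using H c unfolding three_form_def by meson
  show thesis
  proof (rule that[OF h(1)])
    fix s v :: 'v assume s: "s \<in> std_simplex" "base_map \<phi> s \<in> chart_dom c"
    have "snd (simplex_tangent_map A (base_map \<phi>) (s, v)) c =
        frechet_derivative (chart_map c \<circ> base_map \<phi>) (at s within std_simplex) v"
      using s c by (simp add: simplex_tangent_map_def charts_at_def)
    then show "H_form A H \<phi> X Y s v =
        blinfun_apply (blinfun_apply (blinfun_apply (h (chart_map c (base_map \<phi> s)))
          (snd (lift_base A X s) c)) (snd (lift_base A Y s) c))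
          (frechet_derivative (chart_map c \<circ> base_map \<phi>) (at s within std_simplex) v)"
      unfolding H_form_def
      using h(2)[OF s(2) lift_base_tangent(2)[OF X s(1)] lift_base_tangent(2)[OF Y s(1)]
          simplex_tangent_map_tangent_space[OF A base_map_Ck[OF \<phi>] p s(1)]]
      by simp
  qed
qed

text \<open>Used to express the values on the edge directions (0, -1) and (-1, 1) by those on the
  basis vectors.\<close>

lemma linear_H_form:
  fixes A :: "('m, 'e::real_normed_vector) chart set" and \<phi> :: "'v::coordinate_space \<times> 'v \<Rightarrow> _"
  assumes A: "smooth_atlas A" and H: "three_form A H" and p: "p \<ge> 1"
    and \<phi>: "\<phi> \<in> bundle_maps p q A"
    and X: "X \<in> bundle_map_tangents p q A \<phi>" and Y: "Y \<in> bundle_map_tangents p q A \<phi>"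
    and s: "s \<in> std_simplex"
  shows "linear (H_form A H \<phi> X Y s)"
proof -
  have "base_map \<phi> s \<in> points A"
    using base_map_Ck[OF \<phi>] s by (auto simp: Ck_map_def)
  then obtain c where c: "c \<in> A" "base_map \<phi> s \<in> chart_dom c"
    by (auto simp: points_def)
  obtain h where h: "\<And>v. H_form A H \<phi> X Y s v =
        blinfun_apply (blinfun_apply (blinfun_apply (h (chart_map c (base_map \<phi> s)))
          (snd (lift_base A X s) c)) (snd (lift_base A Y s) c))
          (frechet_derivative (chart_map c \<circ> base_map \<phi>) (at s within std_simplex) v)"
    by (rule H_form_chart[OF A H p \<phi> X Y c(1)]) (use s c(2) in blast)
  have "c \<in> charts_at A (base_map \<phi> s)"
    using c by (simp add: charts_at_def)
  from has_derivative_linear[OF Ck_map_chart_has_derivative[OF base_map_Ck[OF \<phi>] p s this]]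
  show ?thesis
    by (intro linearI) (simp_all add: h linear_add linear_scale blinfun.add_right blinfun.scaleR_right)
qed

lemma C1_on_H_form:
  fixes A :: "('m, 'e::real_normed_vector) chart set" and \<phi> :: "'v::coordinate_space \<times> 'v \<Rightarrow> _"
  assumes A: "smooth_atlas A" and H: "three_form A H" and p: "p \<ge> 2"
    and \<phi>: "\<phi> \<in> bundle_maps p q A"
    and X: "X \<in> bundle_map_tangents p q A \<phi>" and Y: "Y \<in> bundle_map_tangents p q A \<phi>"
  shows "C1_on std_simplex (\<lambda>s. H_form A H \<phi> X Y s v)"
proof (rule C1_on_openin_cover[OF convex_std_simplex interior_std_simplex_nonempty])
  let ?S = "std_simplex :: 'v set" and ?f = "base_map \<phi>"
  fix s assume s: "s \<in> ?S"
  then have "?f s \<in> points A"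
    using base_map_Ck[OF \<phi>] by (auto simp: Ck_map_def)
  then obtain c where c: "c \<in> A" "?f s \<in> chart_dom c"
    by (auto simp: points_def)
  let ?U = "?S \<inter> ?f -` chart_dom c"
  obtain k where k: "p = Suc (Suc k)"
    using p by (metis Suc_le_D numeral_2_eq_2 Suc_le_mono)
  have p1: "p \<ge> 1" using p by simp
  obtain h :: "'e \<Rightarrow> 'e \<Rightarrow>\<^sub>L 'e \<Rightarrow>\<^sub>L 'e \<Rightarrow>\<^sub>L real" where h: "smooth_on (chart_map c ` chart_dom c) h"
    "\<And>s v. s \<in> ?S \<Longrightarrow> ?f s \<in> chart_dom c \<Longrightarrow>
      H_form A H \<phi> X Y s v =
        blinfun_apply (blinfun_apply (blinfun_apply (h (chart_map c (?f s)))
          (snd (lift_base A X s) c)) (snd (lift_base A Y s) c))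
          (frechet_derivative (chart_map c \<circ> ?f) (at s within ?S) v)"
    by (rule H_form_chart[OF A H p1 \<phi> X Y c(1)]) blast
  have U: "openin (top_of_set ?S) ?U" and fC: "Ck_on p ?U (chart_map c \<circ> ?f)"
    using base_map_Ck[OF \<phi>] c(1) by (auto simp: Ck_map_def)
  have lift: "C1_on ?U (\<lambda>s. snd (lift_base A Z s) c)" if Z: "Z \<in> bundle_map_tangents p q A \<phi>" for Z
  proof -
    let ?c = "tangent_chart A c"
    \<comment> \<open>Since the lift covers the base map, the chart of M and the induced chart of TM
      cut out the same piece of the simplex.\<close>
    have "?U = ?S \<inter> lift_base A Z -` chart_dom ?c"
      using lift_base_tangent[OF Z] by (auto simp: tangent_chart_def case_prod_beta)
    moreover have "Ck_on p (?S \<inter> lift_base A Z -` chart_dom ?c) (chart_map ?c \<circ> lift_base A Z)"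
      using lift_base_Ck[OF Z] c(1) by (auto simp: Ck_map_def tangent_bundle_def)
    ultimately have "C1_on ?U (chart_map ?c \<circ> lift_base A Z)"
      unfolding k by (simp only: Ck_on_Suc_imp_C1_on)
    then have "C1_on ?U (\<lambda>s. snd ((chart_map ?c \<circ> lift_base A Z) s))"
      by (rule C1_on_snd)
    then show ?thesis
      by (simp add: tangent_chart_def case_prod_beta o_def)
  qed
  have fC1: "C1_on ?U (\<lambda>s. chart_map c (?f s))"
    using Ck_on_Suc_imp_C1_on[OF fC[unfolded k]] by (simp only: o_def)
  have h1: "C1_on ?U (\<lambda>s. h (chart_map c (?f s)))"
    by (rule C1_on_compose_open[OF h(1) _ fC1]) (use A c in \<open>auto simp: smooth_atlas_def\<close>)
  \<comment> \<open>Here p \<ge> 2 enters: directional derivatives of a C^p map are C^{p-1}, hence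
    still C^1.\<close>
  obtain f' where f': "\<And>s. s \<in> ?U \<Longrightarrow> ((chart_map c \<circ> ?f) has_derivative blinfun_apply (f' s)) (at s within ?U)"
    "\<And>v. Ck_on (Suc k) ?U (\<lambda>s. blinfun_apply (f' s) v)"
    using fC unfolding k Ck_on.simps(2)[of "Suc k"] by blast
  have eq: "frechet_derivative (chart_map c \<circ> ?f) (at s within ?S) = blinfun_apply (f' s)" if "s \<in> ?U" for s
    using that f'(1)[OF that] at_within_openin[OF U that]
    by (intro frechet_derivative_within_simplex) auto
  have "C1_on ?U (\<lambda>s. H_form A H \<phi> X Y s v)"
    \<comment> \<open>The product rule once for each argument of the trilinear h.\<close>
    by (rule C1_on_cong[OF C1_on_blinfun_apply[OF C1_on_blinfun_apply[OF C1_on_blinfun_apply[OF h1 lift[OF X]] lift[OF Y]]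
          Ck_on_Suc_imp_C1_on[OF f'(2)]]]) (simp add: h(2) eq)
  with U s c(2) show "\<exists>U. openin (top_of_set ?S) U \<and> s \<in> U \<and> C1_on U (\<lambda>s. H_form A H \<phi> X Y s v)"
    by blast
qed

section \<open>Faces\<close>

text \<open>The edge opposite to vertex 1 is traversed upwards, against the boundary orientation;
  the sign -1 in the coboundary corrects this. The other two edges are traversed along the
  orientation.\<close>

lemma coface_triangle:
  "coface 0 (t::real) = (1 - t, t)" "coface (Suc 0) (t::real) = (0::real, t)" "coface 2 (t::real) = (t, 0::real)"
  by (simp_all add: coface_def vertex_prod_def vertex_real_def)

text \<open>Cofaces are affine, with linear part the difference to the value at 0. The filter is
  arbitrary, so the fact serves both for \<open>coface_tangent\<close> and within the
  simplex.\<close>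

lemma coface_has_derivative:
  "((coface i :: 'v::coordinate_space \<Rightarrow> 'w::coordinate_space) has_derivative (\<lambda>v. coface i v - coface i (0 :: 'v))) F"
  unfolding coface_def Let_def by (auto intro!: derivative_eq_intros)

lemma coface_tangent_eq:
  fixes s v :: "'v::coordinate_space"
  shows "coface_tangent i (s, v) = (coface i s, coface i v - coface i (0 :: 'v))"
  by (simp add: coface_tangent_def frechet_derivative_at[OF coface_has_derivative, symmetric])

text \<open>The type 'v does not fix the dimension of the target, so \<open>sub\<close> records that
  the coface lands in the simplex; \<open>coboundary_phi1\<close> checks it for the three
  edges.\<close>

lemma phi1_face:
  fixes A :: "('m, 'e::real_normed_vector) chart set" and \<phi> :: "'v::coordinate_space \<times> 'v \<Rightarrow> _"
  assumes p: "p \<ge> 1" and \<phi>: "\<phi> \<in> bundle_maps p q A"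
    and sub: "coface i ` (std_simplex :: real set) \<subseteq> (std_simplex :: 'v set)"
  shows "phi1 A H (face i \<phi>) (face i X) (face i Y) =
    integral {0..1} (\<lambda>t::real. H_form A H \<phi> X Y (coface i t) (coface i (1::real) - coface i (0::real)))"
  unfolding phi1_def std_simplex_real
proof (rule integral_cong)
  fix t :: real assume t: "t \<in> {0..1}"
  let ?S = "std_simplex :: 'v set" and ?d = "coface i :: real \<Rightarrow> 'v"
  have base: "base_map (face i \<phi>) = base_map \<phi> \<circ> ?d"
    by (simp add: fun_eq_iff base_map_def face_def coface_tangent_eq)
  have lift: "lift_base A (face i Z) t = lift_base A Z (?d t)" for Z
    by (simp add: lift_base_def face_def coface_tangent_eq)
  have s: "?d t \<in> ?S"
    using sub t by (auto simp: std_simplex_real)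
  have "frechet_derivative (chart_map c \<circ> (base_map \<phi> \<circ> ?d)) (at t within std_simplex) 1 =
      frechet_derivative (chart_map c \<circ> base_map \<phi>) (at (?d t) within ?S) (?d 1 - ?d 0)"
    if c: "c \<in> charts_at A (base_map \<phi> (?d t))" for c
  proof -
    \<comment> \<open>Within an edge alone the derivative is not determined in transversal
      directions; the derivative within the full simplex is restricted to the edge.\<close>
    have "((chart_map c \<circ> base_map \<phi>) has_derivative
        frechet_derivative (chart_map c \<circ> base_map \<phi>) (at (?d t) within ?S)) (at (?d t) within ?d ` std_simplex)"
      by (rule has_derivative_subset[OF Ck_map_chart_has_derivative[OF base_map_Ck[OF \<phi>] p s c] sub])
    from diff_chain_within[OF coface_has_derivative this]
    have "((chart_map c \<circ> (base_map \<phi> \<circ> ?d)) has_derivative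
        frechet_derivative (chart_map c \<circ> base_map \<phi>) (at (?d t) within ?S) \<circ> (\<lambda>v. ?d v - ?d 0))
        (at t within std_simplex)"
      by (simp only: o_assoc)
    from frechet_derivative_within_simplex[OF _ this] t show ?thesis
      by (simp add: std_simplex_real)
  qed
  then have "simplex_tangent_map A (base_map \<phi> \<circ> ?d) (t, 1) = simplex_tangent_map A (base_map \<phi>) (?d t, ?d 1 - ?d 0)"
    by (auto simp: simplex_tangent_map_def)
  then show "H_form A H (face i \<phi>) (face i X) (face i Y) t 1 = H_form A H \<phi> X Y (?d t) (?d 1 - ?d 0)"
    by (simp add: H_form_def base lift)
qed

lemma coboundary_phi1:
  fixes A :: "('m, 'e::real_normed_vector) chart set" and \<phi> :: "(real \<times> real) \<times> (real \<times> real) \<Rightarrow> _"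
  assumes p: "p \<ge> 1" and \<phi>: "\<phi> \<in> bundle_maps p q A"
  shows "coboundary (phi1 A H) \<phi> X Y =
    integral {0..1} (\<lambda>t. H_form A H \<phi> X Y (1 - t, t) (-1, 1)) -
    integral {0..1} (\<lambda>t. H_form A H \<phi> X Y (0, t) (0, 1)) +
    integral {0..1} (\<lambda>t. H_form A H \<phi> X Y (t, 0) (1, 0))"
proof -
  have sub: "coface i ` (std_simplex :: real set) \<subseteq> (std_simplex :: (real \<times> real) set)" if "i \<in> {0, Suc 0, 2}" for i
    using that by (auto simp: coface_triangle std_simplex_triangle std_simplex_real)
  have "{0..DIM(real) + 1} = {0, Suc 0, 2}"
    by auto
  then show ?thesis
    using phi1_face[OF p \<phi> sub] by (simp add: coboundary_def face_pullback_def coface_triangle)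
qed

section \<open>The two cases of \<open>phi2\<close> compared with the coboundary\<close>

lemma triangle_boundary_integral_H_form:
  fixes A :: "('m, 'e::real_normed_vector) chart set" and \<phi> :: "(real \<times> real) \<times> (real \<times> real) \<Rightarrow> _"
  assumes A: "smooth_atlas A" and H: "three_form A H" and p: "p \<ge> 1"
    and \<phi>: "\<phi> \<in> bundle_maps p q A"
    and X: "X \<in> bundle_map_tangents p q A \<phi>" and Y: "Y \<in> bundle_map_tangents p q A \<phi>"
  shows "triangle_boundary_integral (H_form A H \<phi> X Y) = coboundary (phi1 A H) \<phi> X Y"
proof -
  let ?\<omega> = "H_form A H \<phi> X Y"
  \<comment> \<open>Only the left edge differs from its coface: the boundary runs downwards with
    velocity (0, -1), the coface upwards. Linearity gives the sign, reflection the
    parametrisation.\<close>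
  have "?\<omega> (0, 1 - t) (0, -1) = - ?\<omega> (0, 1 - t) (0, 1)" if "t \<in> {0..1}" for t
    using linear_neg[OF linear_H_form[OF A H p \<phi> X Y], of "(0, 1 - t)" "(0, 1)"] that
    by (simp add: std_simplex_triangle)
  then have "integral {0..1} (\<lambda>t. ?\<omega> (0, 1 - t) (0, -1)) = integral {0..1} (\<lambda>t. - ?\<omega> (0, 1 - t) (0, 1))"
    by (rule integral_cong)
  also have "\<dots> = - integral {0..1} (\<lambda>t. ?\<omega> (0, t) (0, 1))"
    using integral_unit_reflect[of "\<lambda>t. ?\<omega> (0, t) (0, 1)"] by simp
  finally show ?thesis
    by (simp add: triangle_boundary_integral_def segment_integral_def linepath_def coboundary_phi1[OF p \<phi>])
qed

text \<open>Green's theorem with P and Q the values of the 1-form on (1, 0) and (0, 1); on the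
  hypotenuse Q - P is by linearity its value on the edge direction (-1, 1).\<close>

lemma integral_ext_deriv_H_form:
  fixes A :: "('m, 'e::real_normed_vector) chart set" and \<phi> :: "(real \<times> real) \<times> (real \<times> real) \<Rightarrow> _"
  assumes A: "smooth_atlas A" and H: "three_form A H" and p: "p \<ge> 2"
    and \<phi>: "\<phi> \<in> bundle_maps p q A"
    and X: "X \<in> bundle_map_tangents p q A \<phi>" and Y: "Y \<in> bundle_map_tangents p q A \<phi>"
  shows "integral std_simplex (\<lambda>s. ext_deriv (H_form A H \<phi> X Y) s (1, 0) (0, 1)) =
    coboundary (phi1 A H) \<phi> X Y"
proof -
  let ?\<omega> = "H_form A H \<phi> X Y"
  have p1: "p \<ge> 1" using p by simp
  note C1 = C1_on_H_form[OF A H p \<phi> X Y]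
  have "?\<omega> (1 - t, t) (0, 1) - ?\<omega> (1 - t, t) (1, 0) = ?\<omega> (1 - t, t) (-1, 1)" if "t \<in> {0..1}" for t
    using linear_diff[OF linear_H_form[OF A H p1 \<phi> X Y], of "(1 - t, t)" "(0, 1)" "(1, 0)"] that
    by (simp add: std_simplex_triangle)
  then have "integral {0..1} (\<lambda>t. ?\<omega> (1 - t, t) (0, 1) - ?\<omega> (1 - t, t) (1, 0)) =
      integral {0..1} (\<lambda>t. ?\<omega> (1 - t, t) (-1, 1))"
    by (rule integral_cong)
  then show ?thesis
    using green_triangle[OF C1[of "(1, 0)"] C1[of "(0, 1)"]]
    by (simp add: ext_deriv_def coboundary_phi1[OF p1 \<phi>])
qed

theorem proposition3p8:
  fixes A :: "('m, 'e::real_normed_vector) chart set"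
    and H :: "'m \<Rightarrow> ('m, 'e) tvec \<Rightarrow> ('m, 'e) tvec \<Rightarrow> ('m, 'e) tvec \<Rightarrow> real"
    and p q :: nat
  assumes "p \<ge> q" and "p \<ge> 1"
    and "smooth_manifold A"
    and "three_form A H"
  shows "\<forall>\<phi>\<in>bundle_maps p q A. \<forall>X\<in>bundle_map_tangents p q A \<phi>. \<forall>Y\<in>bundle_map_tangents p q A \<phi>.
           phi2 p A H \<phi> X Y = coboundary (phi1 A H) \<phi> X Y"
  using assms triangle_boundary_integral_H_form integral_ext_deriv_H_form
  by (auto simp: phi2_def smooth_manifold_def)

end
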